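(* Let $m\ge 8$ be an integer and let $G$ be an $F_2$-free graph with $m$ edges. Then \[ \lambda(G)\le \frac{1+\sqrt{4m-3}}{2}, \] with equality if and only if $G=K_2\vee I_{\frac{m-1}{2}}$ (in particular, equality requires $m$ to be odd).
   Context: All graphs are finite, simple and undirected; when a graph is specified by its number of edges, isolated vertices are ignored (so "$G=H$" means $G$ equals $H$ up to isolated vertices). $\lambda(G)$ denotes the largest eigenvalue of the adjacency matrix of $G$. $F_2$ (the bowtie) is the graph consisting of two triangles sharing exactly one common vertex. A graph is $F_2$-free if it contains no subgraph isomorphic to $F_2$. $I_s$ is the edgeless graph on $s$ vertices, $K_2$ is a single edge, and $G\vee H$ is the join of $G$ and $H$: the disjoint union of $G$ and $H$ together with all edges between $V(G)$ and $V(H)$. *)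

theory Defs
  imports "Jordan_Normal_Form.Spectral_Radius"
begin

record 'a sgraph =
  verts :: "'a set"
  edges :: "'a set set"

definition simple_graph :: "'a sgraph \<Rightarrow> bool" where
  "simple_graph G \<longleftrightarrow> finite (verts G) \<and> (\<forall>e \<in> edges G. e \<subseteq> verts G \<and> card e = 2)"

definition subgraph_of :: "'a sgraph \<Rightarrow> 'a sgraph \<Rightarrow> bool" where
  "subgraph_of H G \<longleftrightarrow> simple_graph H \<and> verts H \<subseteq> verts G \<and> edges H \<subseteq> edges G"

definition graph_isomorphic :: "'a sgraph \<Rightarrow> 'b sgraph \<Rightarrow> bool" where
  "graph_isomorphic G H \<longleftrightarrow>
     (\<exists>f. bij_betw f (verts G) (verts H) \<and>
          (\<forall>u \<in> verts G. \<forall>v \<in> verts G. {u, v} \<in> edges G \<longleftrightarrow> {f u, f v} \<in> edges H))"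

definition graph_free :: "'b sgraph \<Rightarrow> 'a sgraph \<Rightarrow> bool" where
  "graph_free F G \<longleftrightarrow> \<not> (\<exists>H. subgraph_of H G \<and> graph_isomorphic H F)"

definition remove_isolated :: "'a sgraph \<Rightarrow> 'a sgraph" where
  "remove_isolated G = \<lparr>verts = {v \<in> verts G. \<exists>e \<in> edges G. v \<in> e}, edges = edges G\<rparr>"

definition equal_up_to_isolated :: "'a sgraph \<Rightarrow> 'b sgraph \<Rightarrow> bool" where
  "equal_up_to_isolated G H \<longleftrightarrow> graph_isomorphic (remove_isolated G) (remove_isolated H)"

definition bowtie :: "nat sgraph" where
  "bowtie = \<lparr>verts = {0, 1, 2, 3, 4},
     edges = {{0, 1}, {0, 2}, {1, 2}, {0, 3}, {0, 4}, {3, 4}}\<rparr>"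

definition complete_graph :: "nat \<Rightarrow> nat sgraph" where
  "complete_graph n = \<lparr>verts = {..<n}, edges = {e. e \<subseteq> {..<n} \<and> card e = 2}\<rparr>"

definition edgeless_graph :: "nat \<Rightarrow> nat sgraph" where
  "edgeless_graph n = \<lparr>verts = {..<n}, edges = {}\<rparr>"

definition graph_join :: "'a sgraph \<Rightarrow> 'b sgraph \<Rightarrow> ('a + 'b) sgraph" where
  "graph_join G H =
     \<lparr>verts = Inl ` verts G \<union> Inr ` verts H,
      edges = (\<lambda>e. Inl ` e) ` edges G \<union> (\<lambda>e. Inr ` e) ` edges H
        \<union> {{Inl u, Inr v} | u v. u \<in> verts G \<and> v \<in> verts H}\<rparr>"

text \<open>The matrix type is indexed by natural numbers, so the adjacency matrix needs an enumeration
  of the vertices. Any two enumerations give matrices that are similar by a permutation, hence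
  the spectrum does not depend on the choice.\<close>

definition vertex_enumeration :: "'a sgraph \<Rightarrow> 'a list" where
  "vertex_enumeration G = (SOME xs. distinct xs \<and> set xs = verts G)"

definition adjacency_matrix :: "'a sgraph \<Rightarrow> real mat" where
  "adjacency_matrix G =
     (let xs = vertex_enumeration G; n = length xs
      in mat n n (\<lambda>(i, j). if {xs ! i, xs ! j} \<in> edges G then 1 else 0))"

text \<open>\<open>Max\<close> is meaningful whenever the graph has a vertex: the spectrum, here a set of real
  numbers, is finite, and it is nonempty because the matrix is symmetric.\<close>

definition largest_eigenvalue :: "'a sgraph \<Rightarrow> real" where
  "largest_eigenvalue G = Max (spectrum (adjacency_matrix G))"

end

theory Submission
  imports Defs "HOL-Analysis.Function_Topology"
begin

text \<open>
  Let \<open>\<lambda>\<close> be the largest eigenvalue and let \<open>x\<close> be a nonnegative eigenfunction with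
  maximum value 1, attained at \<open>u\<close>. Put \<open>N = N(u)\<close> and let \<open>W\<close> be the set of the other vertices.
  Expanding \<open>(A\<^sup>2 x)(u) - (A x)(u)\<close> and splitting the edges according to \<open>N\<close> and \<open>W\<close>, the hypothesis
  \<open>\<lambda>\<^sup>2 - \<lambda> \<ge> m - 1\<close> becomes
  \<open>\<lambda> + e(N) + e(W) + \<Sum>v\<in>W. d\<^sub>N(v) (1 - x v) \<le> 1 + \<Sum>w\<in>N. \<Sum>z\<in>N(w) \<inter> N. x z\<close>.
  As the graph has no bowtie, the edges inside \<open>N\<close> pairwise intersect, so they form a star or a
  triangle. A star with centre \<open>c\<close> forces equality everywhere: \<open>x c = 1\<close>, \<open>W\<close> is independent, and
  \<open>x v = 1\<close> at every non-isolated \<open>v \<in> W\<close>. The same conclusion at \<open>c\<close> and at such \<open>v\<close> leaves only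
  \<open>K\<^sub>2 \<or> I\<^sub>k\<close>. A triangle forces \<open>\<lambda>\<^sup>2 \<le> 10\<close>, whereas \<open>m \<ge> 8\<close> gives \<open>\<lambda>\<^sup>2 \<ge> 7 + \<lambda> > 10\<close>.
\<close>

text \<open>Perron--Frobenius by maximising the Rayleigh quotient over the nonnegative unit vectors.\<close>

lemma symmetric_nonneg_top_eigenfunction:
  fixes a :: "'a \<Rightarrow> 'a \<Rightarrow> real"
  assumes fin: "finite V" and ne: "V \<noteq> {}"
    and sym: "\<And>v w. a v w = a w v" and nonneg: "\<And>v w. 0 \<le> a v w"
  obtains k f where "\<And>v. 0 \<le> f v" and "\<exists>v\<in>V. f v \<noteq> 0"
    and "\<And>v. v \<in> V \<Longrightarrow> (\<Sum>w\<in>V. a v w * f w) = k * f v"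
    and "\<And>l g. \<exists>v\<in>V. g v \<noteq> 0 \<Longrightarrow> (\<And>v. v \<in> V \<Longrightarrow> (\<Sum>w\<in>V. a v w * g w) = l * g v) \<Longrightarrow> l \<le> k"
proof -
  define A where "A g v = (\<Sum>w\<in>V. a v w * g w)" for g v
  define Q where "Q g = (\<Sum>v\<in>V. g v * A g v)" for g
  define n where "n g = (\<Sum>v\<in>V. (g v)\<^sup>2)" for g :: "'a \<Rightarrow> real"
  \<comment> \<open>Pinning the values off \<open>V\<close> to 0 makes the ambient set a product of
    compact sets, so Tychonoff applies to functions on the whole type. The interval from 0 to 1
    builds nonnegativity into the maximiser.\<close>
  define S where "S = PiE UNIV (\<lambda>v. if v \<in> V then {0..1::real} else {0}) \<inter> {f. n f = 1}"
  have "compactin (product_topology (\<lambda>i. euclidean) UNIV) (PiE UNIV (\<lambda>v. if v \<in> V then {0..1::real} else {0}))"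
    by (subst compactin_PiE) auto
  then have "compact (PiE UNIV (\<lambda>v. if v \<in> V then {0..1::real} else {0}))"
    by (simp add: euclidean_product_topology)
  moreover have "continuous_on UNIV n"
    unfolding n_def by (intro continuous_intros continuous_on_product_coordinates)
  then have "closed {f. n f = 1}"
    by (intro closed_Collect_eq) auto
  ultimately have comp: "compact S"
    unfolding S_def by (rule compact_Int_closed)
  obtain v0 where v0: "v0 \<in> V" using ne by auto
  have "n (\<lambda>v. if v = v0 then 1 else 0) = (\<Sum>v\<in>V. if v = v0 then 1 else 0)"
    unfolding n_def by (intro sum.cong) auto
  also have "\<dots> = 1" using fin v0 by simp
  finally have "(\<lambda>v. if v = v0 then 1 else 0) \<in> S"
    using v0 by (auto simp: S_def)
  then have "S \<noteq> {}" by auto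
  moreover have "continuous_on S Q"
    unfolding Q_def A_def
    by (intro continuous_intros continuous_on_subset[OF continuous_on_product_coordinates]) auto
  ultimately obtain f where fS: "f \<in> S" and fmax: "\<And>g. g \<in> S \<Longrightarrow> Q g \<le> Q f"
    using continuous_attains_sup[OF comp] by blast
  define k where "k = Q f"
  have n_nonneg: "0 \<le> n g" for g unfolding n_def by (intro sum_nonneg) auto
  have n_zero: "n g = 0 \<longleftrightarrow> (\<forall>v\<in>V. g v = 0)" for g
    unfolding n_def using fin by (simp add: sum_nonneg_eq_0_iff)
  have rayleigh: "Q g \<le> k * n g" for g
  proof (cases "n g = 0")
    case True
    then have "Q g = 0" using n_zero[of g] unfolding Q_def by (intro sum.neutral) auto
    with True show ?thesis by simp
  next
    case False
    define s where "s = sqrt (n g)"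
    have s: "0 < s" "s\<^sup>2 = n g" using False n_nonneg[of g] by (auto simp: s_def)
    \<comment> \<open>Passing to absolute values cannot lower \<open>Q\<close>, as the weights are
      nonnegative, and scaling then lands in \<open>S\<close>. So the maximum over nonnegative
      functions bounds \<open>Q\<close> on all functions.\<close>
    define h where "h v = (if v \<in> V then \<bar>g v\<bar> / s else 0)" for v
    have "n h = (\<Sum>v\<in>V. (g v)\<^sup>2 / n g)"
      unfolding n_def[of h] using s by (intro sum.cong) (auto simp: h_def power_divide)
    also have "\<dots> = 1" using False by (simp add: sum_divide_distrib[symmetric] n_def)
    finally have nh: "n h = 1" .
    have "h v \<le> 1" if "v \<in> V" for v
    proof -
      have "(h v)\<^sup>2 \<le> n h" unfolding n_def by (rule member_le_sum) (use that fin in auto)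
      then show ?thesis using nh by (simp add: power2_le_iff_abs_le abs_square_le_1)
    qed
    then have "h \<in> S" using nh s by (auto simp: S_def h_def)
    then have "Q h \<le> k" using fmax k_def by auto
    have "Q g \<le> (\<Sum>v\<in>V. \<Sum>w\<in>V. a v w * \<bar>g v\<bar> * \<bar>g w\<bar>)"
      unfolding Q_def A_def sum_distrib_left
    proof (intro sum_mono)
      fix v w
      have gg: "g v * g w \<le> \<bar>g v\<bar> * \<bar>g w\<bar>" by (metis abs_ge_self abs_mult)
      then show "g v * (a v w * g w) \<le> a v w * \<bar>g v\<bar> * \<bar>g w\<bar>"
        using mult_left_mono[OF gg nonneg[of v w]] by (simp add: algebra_simps)
    qed
    also have "\<dots> = (\<Sum>v\<in>V. \<Sum>w\<in>V. s\<^sup>2 * (h v * (a v w * h w)))"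
      using s by (intro sum.cong) (auto simp: h_def power2_eq_square)
    also have "\<dots> = s\<^sup>2 * Q h"
      unfolding Q_def A_def by (simp add: sum_distrib_left)
    also have "\<dots> \<le> s\<^sup>2 * k" using \<open>Q h \<le> k\<close> by (simp add: mult_left_mono)
    finally show ?thesis using s by (simp add: mult.commute)
  qed
  have nf: "n f = 1" using fS by (auto simp: S_def)
  \<comment> \<open>The residual \<open>r\<close> of the eigenvalue equation serves as the direction
    of perturbation: maximality of \<open>f\<close> along \<open>f + t r\<close> will force
    \<open>r\<close> to vanish on \<open>V\<close>.\<close>
  define r where "r v = A f v - k * f v" for v
  have A_lin: "A (\<lambda>v. f v + t * r v) v = A f v + t * A r v" for t v
    unfolding A_def by (simp add: algebra_simps sum.distrib sum_distrib_left)
  have "(\<Sum>v\<in>V. f v * A r v) = (\<Sum>v\<in>V. \<Sum>w\<in>V. f v * (a v w * r w))"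
    unfolding A_def by (simp add: sum_distrib_left)
  also have "\<dots> = (\<Sum>w\<in>V. \<Sum>v\<in>V. f v * (a v w * r w))"
    by (rule sum.swap)
  also have "\<dots> = (\<Sum>w\<in>V. r w * A f w)"
    unfolding A_def sum_distrib_left by (intro sum.cong) (auto simp: sym[of _ w for w] algebra_simps)
  finally have adj: "(\<Sum>v\<in>V. f v * A r v) = (\<Sum>v\<in>V. r v * A f v)" .
  have Q_exp: "Q (\<lambda>v. f v + t * r v) = k + 2 * t * (\<Sum>v\<in>V. r v * A f v) + t\<^sup>2 * Q r" for t
  proof -
    have "Q (\<lambda>v. f v + t * r v)
        = (\<Sum>v\<in>V. f v * A f v + t * (f v * A r v) + t * (r v * A f v) + t\<^sup>2 * (r v * A r v))"
      unfolding Q_def A_lin by (intro sum.cong) (auto simp: algebra_simps power2_eq_square)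
    then show ?thesis
      unfolding k_def Q_def by (simp add: sum.distrib sum_distrib_left[symmetric] adj)
  qed
  have n_exp: "n (\<lambda>v. f v + t * r v) = 1 + 2 * t * (\<Sum>v\<in>V. r v * f v) + t\<^sup>2 * n r" for t
  proof -
    have "n (\<lambda>v. f v + t * r v) = (\<Sum>v\<in>V. (f v)\<^sup>2 + 2 * t * (r v * f v) + t\<^sup>2 * (r v)\<^sup>2)"
      unfolding n_def by (intro sum.cong) (auto simp: algebra_simps power2_eq_square)
    then show ?thesis
      using nf unfolding n_def by (simp add: sum.distrib sum_distrib_left[symmetric])
  qed
  have nr: "n r = (\<Sum>v\<in>V. r v * A f v) - k * (\<Sum>v\<in>V. r v * f v)"
    unfolding n_def sum_distrib_left sum_subtractf[symmetric]
    by (intro sum.cong) (auto simp: r_def power2_eq_square algebra_simps)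
  define c where "c = k * n r - Q r"
  have quad: "2 * t * n r \<le> t\<^sup>2 * c" for t
    using rayleigh[of "\<lambda>v. f v + t * r v"]
    unfolding Q_exp n_exp nr c_def by (simp add: algebra_simps)
  \<comment> \<open>By \<open>quad\<close>, \<open>t\<^sup>2 c - 2 t n r\<close> is never negative.
    For \<open>c > 0\<close> its minimiser \<open>t = n r / c\<close> gives
    \<open>- (n r)\<^sup>2 / c\<close>, which forces \<open>n r = 0\<close>; for
    \<open>c = 0\<close> any positive \<open>t\<close> will do.\<close>
  have "n r = 0"
  proof (cases "c = 0")
    case True
    then show ?thesis using quad[of 1] n_nonneg[of r] by simp
  next
    case False
    then have "c > 0" using rayleigh[of r] by (simp add: c_def)
    moreover from this have "(n r / c)\<^sup>2 * c = n r * n r / c" by (simp add: power2_eq_square)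
    ultimately have "n r * n r / c \<le> 0" using quad[of "n r / c"] by simp
    then show ?thesis using \<open>c > 0\<close> n_nonneg[of r] by (auto simp: divide_le_0_iff mult_le_0_iff)
  qed
  then have "r v = 0" if "v \<in> V" for v
    using that n_zero by blast
  then have eig: "A f v = k * f v" if "v \<in> V" for v
    using that by (simp add: r_def)
  have top: "l \<le> k"
    if "\<exists>v\<in>V. g v \<noteq> 0" and g: "\<And>v. v \<in> V \<Longrightarrow> A g v = l * g v" for l g
  proof -
    have "Q g = l * n g"
      unfolding Q_def n_def sum_distrib_left
      by (intro sum.cong) (auto simp: g power2_eq_square)
    moreover have "n g > 0" using that(1) n_zero[of g] n_nonneg[of g] by auto
    ultimately show ?thesis using rayleigh[of g] by simp
  qed
  show thesis
  proof (rule that[of f k])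
    show "0 \<le> f v" for v
      using fS by (cases "v \<in> V") (auto simp: S_def PiE_def Pi_def split: if_splits)
    show "\<exists>v\<in>V. f v \<noteq> 0" using n_zero[of f] nf by auto
    show "(\<Sum>w\<in>V. a v w * f w) = k * f v" if "v \<in> V" for v
      using eig[OF that] by (simp add: A_def)
    show "l \<le> k" if "\<exists>v\<in>V. g v \<noteq> 0"
      "\<And>v. v \<in> V \<Longrightarrow> (\<Sum>w\<in>V. a v w * g w) = l * g v" for l g
      by (rule top[OF that(1)]) (use that(2) in \<open>simp add: A_def\<close>)
  qed
qed

subsection \<open>Eigenfunctions of a graph\<close>

definition nbrs :: "'a sgraph \<Rightarrow> 'a \<Rightarrow> 'a set" where
  "nbrs G v = {w. {v, w} \<in> edges G}"

text \<open>The equation is stated on vertices instead of matrix indices, so that the combinatorial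
  argument never meets the vertex enumeration.\<close>

definition eigenfunction :: "'a sgraph \<Rightarrow> real \<Rightarrow> ('a \<Rightarrow> real) \<Rightarrow> bool" where
  "eigenfunction G k f \<longleftrightarrow>
     (\<exists>v\<in>verts G. f v \<noteq> 0) \<and> (\<forall>v\<in>verts G. (\<Sum>w\<in>nbrs G v. f w) = k * f v)"

lemma nbrs_commute: "w \<in> nbrs G v \<longleftrightarrow> v \<in> nbrs G w"
  by (simp add: nbrs_def insert_commute)

lemma nbrs_subset_verts: "simple_graph G \<Longrightarrow> nbrs G v \<subseteq> verts G"
  by (auto simp: nbrs_def simple_graph_def)

lemma not_in_nbrs_self: "simple_graph G \<Longrightarrow> v \<notin> nbrs G v"
  by (fastforce simp: nbrs_def simple_graph_def)

lemma finite_nbrs: "simple_graph G \<Longrightarrow> finite (nbrs G v)"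
  using nbrs_subset_verts finite_subset unfolding simple_graph_def by metis

lemma sum_nbrs:
  fixes f :: "'a \<Rightarrow> real"
  assumes "simple_graph G"
  shows "(\<Sum>w\<in>verts G. (if {v, w} \<in> edges G then 1 else 0) * f w) = (\<Sum>w\<in>nbrs G v. f w)"
proof -
  have "nbrs G v = {w \<in> verts G. {v, w} \<in> edges G}"
    using nbrs_subset_verts[OF assms] by (auto simp: nbrs_def)
  then show ?thesis
    using assms by (auto simp: sum.inter_filter simple_graph_def intro!: sum.cong)
qed

lemma vertex_enumeration:
  assumes "simple_graph G"
  shows "distinct (vertex_enumeration G)" "set (vertex_enumeration G) = verts G"
proof -
  have "\<exists>xs. distinct xs \<and> set xs = verts G"
    using assms finite_distinct_list unfolding simple_graph_def by metis
  from someI_ex[OF this] show "distinct (vertex_enumeration G)" "set (vertex_enumeration G) = verts G"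
    unfolding vertex_enumeration_def by auto
qed

text \<open>The enumeration is a bijection from indices to vertices, so each entry of the
  matrix-vector product becomes a sum over neighbours.\<close>

lemma spectrum_adjacency_matrix:
  assumes G: "simple_graph G"
  shows "k \<in> spectrum (adjacency_matrix G) \<longleftrightarrow> (\<exists>f. eigenfunction G k f)"
proof -
  define xs where "xs = vertex_enumeration G"
  define n where "n = length xs"
  have dist: "distinct xs" and set: "set xs = verts G"
    using vertex_enumeration[OF G] by (auto simp: xs_def)
  have bij: "bij_betw ((!) xs) {..<n} (verts G)"
    using bij_betw_nth[OF dist] set n_def by auto
  have A: "adjacency_matrix G
      = mat n n (\<lambda>(i, j). if {xs ! i, xs ! j} \<in> edges G then 1 else 0)"
    by (simp add: adjacency_matrix_def xs_def n_def Let_def)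
  have row: "(adjacency_matrix G *\<^sub>v vec n (\<lambda>i. f (xs ! i))) $ i = (\<Sum>w\<in>nbrs G (xs ! i). f w)"
    if "i < n" for f i
  proof -
    have "(adjacency_matrix G *\<^sub>v vec n (\<lambda>i. f (xs ! i))) $ i
        = (\<Sum>j<n. (if {xs ! i, xs ! j} \<in> edges G then 1 else 0) * f (xs ! j))"
      using that by (simp add: A scalar_prod_def lessThan_atLeast0)
    also have "\<dots> = (\<Sum>w\<in>verts G. (if {xs ! i, w} \<in> edges G then 1 else 0) * f w)"
      by (rule sum.reindex_bij_betw[OF bij])
    finally show ?thesis using sum_nbrs[OF G] by simp
  qed
  have eq: "eigenvector (adjacency_matrix G) (vec n (\<lambda>i. f (xs ! i))) k \<longleftrightarrow> eigenfunction G k f" for f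
  proof -
    have dim: "dim_row (adjacency_matrix G) = n" by (simp add: A)
    have all: "(\<forall>v\<in>verts G. P v) \<longleftrightarrow> (\<forall>i<n. P (xs ! i))" for P
      unfolding set[symmetric] n_def by (rule all_set_conv_all_nth)
    have "vec n (\<lambda>i. f (xs ! i)) = 0\<^sub>v n \<longleftrightarrow> (\<forall>v\<in>verts G. f v = 0)"
      unfolding all by (simp add: vec_eq_iff)
    moreover have "adjacency_matrix G *\<^sub>v vec n (\<lambda>i. f (xs ! i)) = k \<cdot>\<^sub>v vec n (\<lambda>i. f (xs ! i))
        \<longleftrightarrow> (\<forall>i<n. (adjacency_matrix G *\<^sub>v vec n (\<lambda>i. f (xs ! i))) $ i = k * f (xs ! i))"
      by (simp add: vec_eq_iff dim)
    moreover have "\<dots> \<longleftrightarrow> (\<forall>v\<in>verts G. (\<Sum>w\<in>nbrs G v. f w) = k * f v)"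
      unfolding all using row by simp
    ultimately show ?thesis
      unfolding eigenvector_def eigenfunction_def dim by auto
  qed
  show ?thesis
  proof
    assume "k \<in> spectrum (adjacency_matrix G)"
    then obtain v where v: "eigenvector (adjacency_matrix G) v k"
      by (auto simp: spectrum_def eigenvalue_def)
    then have "v \<in> carrier_vec n" by (simp add: eigenvector_def A)
    define f where "f w = v $ (inv_into {..<n} ((!) xs) w)" for w
    have "f (xs ! i) = v $ i" if "i < n" for i
      using bij_betw_inv_into_left[OF bij] that by (simp add: f_def)
    then have "vec n (\<lambda>i. f (xs ! i)) = v"
      using \<open>v \<in> carrier_vec n\<close> by (auto simp: vec_eq_iff)
    then show "\<exists>f. eigenfunction G k f" using eq[of f] v by auto
  next
    assume "\<exists>f. eigenfunction G k f"
    then show "k \<in> spectrum (adjacency_matrix G)"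
      using eq by (auto simp: spectrum_def eigenvalue_def)
  qed
qed

lemma finite_spectrum_adjacency_matrix: "finite (spectrum (adjacency_matrix G))"
  by (rule card_finite_spectrum(1)[of _ "length (vertex_enumeration G)"])
    (simp add: adjacency_matrix_def Let_def)

lemma eigenfunction_le_largest_eigenvalue:
  assumes "simple_graph G" "eigenfunction G k f"
  shows "k \<le> largest_eigenvalue G"
  unfolding largest_eigenvalue_def
  using finite_spectrum_adjacency_matrix spectrum_adjacency_matrix[OF assms(1)] assms(2)
  by (intro Max_ge) auto

text \<open>For the 0/1 adjacency weights, the maximal Rayleigh quotient belongs to the spectrum and
  dominates each of its members, so it is the \<open>Max\<close>.\<close>

lemma perron_eigenfunction:
  assumes G: "simple_graph G" and ne: "verts G \<noteq> {}"
  obtains f where "eigenfunction G (largest_eigenvalue G) f" and "\<And>v. 0 \<le> f v"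
proof -
  define a :: "'a \<Rightarrow> 'a \<Rightarrow> real" where "a v w = (if {v, w} \<in> edges G then 1 else 0)" for v w
  have fin: "finite (verts G)" using G by (simp add: simple_graph_def)
  have a: "a v w = a w v" "0 \<le> a v w" for v w by (auto simp: a_def insert_commute)
  show thesis
  proof (rule symmetric_nonneg_top_eigenfunction[where V = "verts G" and a = a, OF fin ne a])
    fix k f
    assume f: "\<And>v. 0 \<le> f v" "\<exists>v\<in>verts G. f v \<noteq> 0"
        "\<And>v. v \<in> verts G \<Longrightarrow> (\<Sum>w\<in>verts G. a v w * f w) = k * f v"
      and top: "\<And>l g. \<exists>v\<in>verts G. g v \<noteq> 0 \<Longrightarrow>
        (\<And>v. v \<in> verts G \<Longrightarrow> (\<Sum>w\<in>verts G. a v w * g w) = l * g v) \<Longrightarrow> l \<le> k"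
    have ev: "eigenfunction G k f"
      using f(2,3) by (simp add: eigenfunction_def a_def sum_nbrs[OF G])
    have "k = largest_eigenvalue G"
      unfolding largest_eigenvalue_def
    proof (rule Max_eqI[symmetric])
      show "finite (spectrum (adjacency_matrix G))" by (rule finite_spectrum_adjacency_matrix)
      show "k \<in> spectrum (adjacency_matrix G)" using ev spectrum_adjacency_matrix[OF G] by auto
      fix l assume "l \<in> spectrum (adjacency_matrix G)"
      then obtain g where "eigenfunction G l g" using spectrum_adjacency_matrix[OF G] by auto
      then show "l \<le> k"
        by (intro top[of g]) (auto simp: eigenfunction_def a_def sum_nbrs[OF G])
    qed
    with ev f(1) that show thesis by auto
  qed
qed

subsection \<open>The neighbourhood of a maximum of the eigenfunction\<close>

text \<open>For distinct \<open>u\<close>, \<open>c\<close> outside \<open>L\<close>, this is the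
  edge set of the join of an edge with the independent set \<open>L\<close>: triangles sharing the
  edge \<open>{u, c}\<close>, one for each \<open>l\<close> in \<open>L\<close>.\<close>

definition book :: "'a \<Rightarrow> 'a \<Rightarrow> 'a set \<Rightarrow> 'a set set" where
  "book u c L = insert {u, c} ((\<lambda>l. {u, l}) ` L \<union> (\<lambda>l. {c, l}) ` L)"

lemma nbrs_in_verts: "simple_graph G \<Longrightarrow> w \<in> nbrs G v \<Longrightarrow> v \<in> verts G \<and> w \<in> verts G"
  by (auto simp: nbrs_def simple_graph_def)

lemma edge_cases:
  assumes "simple_graph G" "e \<in> edges G"
  obtains v w where "e = {v, w}" "w \<in> nbrs G v" "v \<noteq> w"
proof -
  have "card e = 2" using assms by (auto simp: simple_graph_def)
  then obtain v w where "e = {v, w}" "v \<noteq> w" by (auto simp: card_2_iff)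
  with assms that show thesis by (auto simp: nbrs_def)
qed

section \<open>Counting edges relative to a vertex neighbourhood\<close>

lemma finite_edges: "simple_graph G \<Longrightarrow> finite (edges G)"
  by (rule finite_subset[of _ "Pow (verts G)"]) (auto simp: simple_graph_def)

text \<open>No edge joins \<open>u\<close> to \<open>W\<close>, so an edge contains
  \<open>u\<close>, lies inside \<open>N\<close>, lies inside \<open>W\<close>, or joins
  \<open>N\<close> to \<open>W\<close>. The last kind is counted from its end in
  \<open>W\<close>.\<close>

lemma card_edges_split:
  assumes G: "simple_graph G" and u: "u \<in> verts G"
  defines "N \<equiv> nbrs G u"
  defines "W \<equiv> verts G - insert u N"
  shows "card (edges G) = card N + card {e \<in> edges G. e \<subseteq> N}
    + (\<Sum>v\<in>W. card (nbrs G v \<inter> N)) + card {e \<in> edges G. e \<subseteq> W}"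
proof -
  define A where "A = (\<lambda>w. {u, w}) ` N"
  define B where "B = {e \<in> edges G. e \<subseteq> N}"
  \<comment> \<open>As \<open>W\<close> and \<open>N\<close> are disjoint, an unordered edge
    determines which end comes first, so the image has the size of the set of pairs.\<close>
  define C where "C = (\<lambda>(v, w). {v, w}) ` (SIGMA v:W. nbrs G v \<inter> N)"
  define D where "D = {e \<in> edges G. e \<subseteq> W}"
  have fin: "finite N" "finite W" "finite B" "finite D"
    using G finite_nbrs[OF G] finite_edges[OF G] by (auto simp: N_def W_def B_def D_def simple_graph_def)
  have uN: "u \<notin> N" using not_in_nbrs_self[OF G] by (simp add: N_def)
  have "edges G = A \<union> B \<union> C \<union> D"
  proof
    show "A \<union> B \<union> C \<union> D \<subseteq> edges G"
      by (auto simp: A_def B_def C_def D_def N_def nbrs_def)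
    show "edges G \<subseteq> A \<union> B \<union> C \<union> D"
    proof
      fix e assume e: "e \<in> edges G"
      then obtain v w where vw: "e = {v, w}" "w \<in> nbrs G v" "v \<noteq> w" by (rule edge_cases[OF G])
      have wv: "v \<in> nbrs G w" using vw nbrs_commute by metis
      have V: "v \<in> verts G" "w \<in> verts G" using nbrs_in_verts[OF G vw(2)] by auto
      consider "v = u" | "w = u" | "v \<in> N" "w \<in> N" | "v \<in> W" "w \<in> N" | "v \<in> N" "w \<in> W" | "v \<in> W" "w \<in> W"
        using V by (auto simp: W_def)
      then show "e \<in> A \<union> B \<union> C \<union> D"
      proof cases
        case 1 then have "e \<in> A" using vw by (auto simp: A_def N_def) then show ?thesis by simp
      next
        case 2 then have "e \<in> A" using vw wv by (auto simp: A_def N_def) then show ?thesis by simp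
      next
        case 3 then show ?thesis using vw e by (auto simp: B_def)
      next
        case 4 then have "e \<in> C" using vw by (force simp: C_def) then show ?thesis by simp
      next
        case 5 then have "e \<in> C" using vw wv by (force simp: C_def) then show ?thesis by simp
      next
        case 6 then show ?thesis using vw e by (auto simp: D_def)
      qed
    qed
  qed
  moreover have "A \<inter> B = {}" "(A \<union> B) \<inter> C = {}"
    using uN by (auto simp: A_def B_def C_def W_def doubleton_eq_iff)
  moreover have "(A \<union> B \<union> C) \<inter> D = {}"
  proof -
    \<comment> \<open>The empty set would fit both \<open>B\<close> and \<open>D\<close>, so it must
      be ruled out as an edge.\<close>
    have "e \<noteq> {}" if "e \<in> edges G" for e using that G by (auto simp: simple_graph_def)
    then show ?thesis by (fastforce simp: A_def B_def C_def D_def W_def)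
  qed
  moreover have "finite A" "finite C"
    using fin by (auto simp: A_def C_def)
  ultimately have "card (edges G) = card A + card B + card C + card D"
    using fin by (simp add: card_Un_disjoint)
  moreover have "card A = card N"
    unfolding A_def by (rule card_image) (auto simp: inj_on_def doubleton_eq_iff)
  moreover have "card C = card (SIGMA v:W. nbrs G v \<inter> N)"
    unfolding C_def by (rule card_image) (auto simp: inj_on_def doubleton_eq_iff W_def)
  ultimately show ?thesis
    using fin by (simp add: B_def D_def)
qed

text \<open>The situation in which the bound is attained or exceeded, with \<open>x\<close> scaled
  to values at most 1. Bowtie-freeness enters only through \<open>disjoint_edges\<close>, and
  \<open>m \<ge> 8\<close> only through \<open>lam_ge\<close>. No vertex is fixed, so that what is
  proved at one vertex of value 1 can be applied again at others.\<close>

locale extremal_eigenfunction =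
  fixes G :: "'a sgraph" and x :: "'a \<Rightarrow> real" and lam :: real
  assumes G: "simple_graph G"
    and disjoint_edges: "\<And>p a b c d. \<lbrakk>a \<in> nbrs G p; b \<in> nbrs G p; b \<in> nbrs G a;
      c \<in> nbrs G p; d \<in> nbrs G p; d \<in> nbrs G c\<rbrakk> \<Longrightarrow> {a, b} \<inter> {c, d} \<noteq> {}"
    and eig: "\<And>v. v \<in> verts G \<Longrightarrow> (\<Sum>w\<in>nbrs G v. x w) = lam * x v"
    and x_nonneg: "\<And>v. 0 \<le> x v"
    and x_le_1: "\<And>v. v \<in> verts G \<Longrightarrow> x v \<le> 1"
    and lam_pos: "0 < lam"
    and lam_ge: "lam\<^sup>2 - lam \<ge> 7"
    and extremal: "lam\<^sup>2 - lam \<ge> real (card (edges G)) - 1"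
begin

section \<open>Bounds on the eigenvalue and the local inequality\<close>

lemma lam_gt_3: "3 < lam"
proof (rule ccontr)
  assume "\<not> 3 < lam"
  then have "lam * (lam - 1) \<le> 3 * (lam - 1)" if "1 \<le> lam"
    using that by (intro mult_right_mono) auto
  moreover have "lam * (lam - 1) \<le> 0" if "lam \<le> 1"
    using that lam_pos by (simp add: mult_le_0_iff)
  ultimately have "lam * (lam - 1) \<le> 6"
    using \<open>\<not> 3 < lam\<close> by (cases "lam \<le> 1") auto
  with lam_ge show False by (simp add: power2_eq_square algebra_simps)
qed

lemma lam_sq_gt_10: "10 < lam\<^sup>2"
  using lam_gt_3 lam_ge by simp

abbreviation W :: "'a \<Rightarrow> 'a set" where
  "W u \<equiv> verts G - insert u (nbrs G u)"

lemma fin: "finite (verts G)" "finite (nbrs G v)"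
  using G finite_nbrs[OF G] by (auto simp: simple_graph_def)

lemma x_nbr_le_1: "w \<in> nbrs G v \<Longrightarrow> x w \<le> 1"
  using nbrs_in_verts[OF G] x_le_1 by metis

lemma nbrs_partition:
  assumes "w \<in> nbrs G u"
  shows "(\<Sum>z\<in>nbrs G w. x z) = x u + (\<Sum>z\<in>nbrs G w \<inter> nbrs G u. x z) + (\<Sum>z\<in>nbrs G w \<inter> W u. x z)"
proof -
  have "nbrs G w = insert u ((nbrs G w \<inter> nbrs G u) \<union> (nbrs G w \<inter> W u))"
    using assms nbrs_commute[of w G u] nbrs_subset_verts[OF G, of w] by auto
  then have "(\<Sum>z\<in>nbrs G w. x z) = (\<Sum>z\<in>insert u ((nbrs G w \<inter> nbrs G u) \<union> (nbrs G w \<inter> W u)). x z)"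
    by simp
  also have "\<dots> = x u + (\<Sum>z\<in>(nbrs G w \<inter> nbrs G u) \<union> (nbrs G w \<inter> W u). x z)"
    using fin not_in_nbrs_self[OF G] by (subst sum.insert) auto
  also have "(\<Sum>z\<in>(nbrs G w \<inter> nbrs G u) \<union> (nbrs G w \<inter> W u). x z)
      = (\<Sum>z\<in>nbrs G w \<inter> nbrs G u. x z) + (\<Sum>z\<in>nbrs G w \<inter> W u. x z)"
    using fin by (intro sum.union_disjoint) auto
  finally show ?thesis by simp
qed

text \<open>Double counting of the edges between \<open>nbrs G u\<close> and \<open>W u\<close>,
  regrouped by their end in \<open>W u\<close>.\<close>

lemma sum_outer_swap:
  "(\<Sum>w\<in>nbrs G u. \<Sum>z\<in>nbrs G w \<inter> W u. x z) = (\<Sum>v\<in>W u. real (card (nbrs G v \<inter> nbrs G u)) * x v)"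
proof -
  have "(\<Sum>w\<in>nbrs G u. \<Sum>z\<in>nbrs G w \<inter> W u. x z) = (\<Sum>w\<in>nbrs G u. \<Sum>z\<in>{z \<in> W u. z \<in> nbrs G w}. x z)"
    by (intro sum.cong) auto
  also have "\<dots> = (\<Sum>v\<in>W u. \<Sum>w\<in>{w \<in> nbrs G u. v \<in> nbrs G w}. x v)"
    using fin by (intro sum.swap_restrict) auto
  also have "\<dots> = (\<Sum>v\<in>W u. real (card (nbrs G v \<inter> nbrs G u)) * x v)"
  proof (intro sum.cong refl)
    fix v
    have "{w \<in> nbrs G u. v \<in> nbrs G w} = nbrs G v \<inter> nbrs G u"
      using nbrs_commute[of _ G v] by auto
    then show "(\<Sum>w\<in>{w \<in> nbrs G u. v \<in> nbrs G w}. x v) = real (card (nbrs G v \<inter> nbrs G u)) * x v"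
      by simp
  qed
  finally show ?thesis .
qed

text \<open>Two uses of the eigenvalue equation turn \<open>lam\<^sup>2\<close> into a sum over
  walks of length two from \<open>u\<close>. Since \<open>x u = 1\<close>, walks back to
  \<open>u\<close> contribute the degree of \<open>u\<close>, which cancels against the same term of
  the edge count in \<open>extremal\<close>.\<close>

lemma local_inequality:
  assumes u: "u \<in> verts G" "x u = 1"
  shows "lam + real (card {e \<in> edges G. e \<subseteq> nbrs G u}) + real (card {e \<in> edges G. e \<subseteq> W u})
      + (\<Sum>v\<in>W u. real (card (nbrs G v \<inter> nbrs G u)) * (1 - x v))
    \<le> (\<Sum>w\<in>nbrs G u. \<Sum>z\<in>nbrs G w \<inter> nbrs G u. x z) + 1"
proof -
  have lam: "lam = (\<Sum>w\<in>nbrs G u. x w)" using eig u by simp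
  have "lam\<^sup>2 = (\<Sum>w\<in>nbrs G u. lam * x w)"
    by (subst power2_eq_square, subst (2) lam) (simp add: sum_distrib_left)
  also have "\<dots> = (\<Sum>w\<in>nbrs G u. \<Sum>z\<in>nbrs G w. x z)"
    by (intro sum.cong refl) (metis eig nbrs_in_verts[OF G])
  also have "\<dots> = (\<Sum>w\<in>nbrs G u. 1 + (\<Sum>z\<in>nbrs G w \<inter> nbrs G u. x z) + (\<Sum>z\<in>nbrs G w \<inter> W u. x z))"
    by (intro sum.cong refl) (use nbrs_partition u in simp)
  finally have sq: "lam\<^sup>2 = real (card (nbrs G u)) + (\<Sum>w\<in>nbrs G u. \<Sum>z\<in>nbrs G w \<inter> nbrs G u. x z)
      + (\<Sum>v\<in>W u. real (card (nbrs G v \<inter> nbrs G u)) * x v)"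
    by (simp only: sum.distrib sum_outer_swap) simp
  have "(\<Sum>v\<in>W u. real (card (nbrs G v \<inter> nbrs G u)) * (1 - x v))
      = real (\<Sum>v\<in>W u. card (nbrs G v \<inter> nbrs G u)) - (\<Sum>v\<in>W u. real (card (nbrs G v \<inter> nbrs G u)) * x v)"
    by (simp add: algebra_simps sum_subtractf)
  then show ?thesis
    using extremal sq card_edges_split[OF G u(1)] by simp
qed

lemma deficiency_nonneg:
  "0 \<le> (\<Sum>v\<in>W u. real (card (nbrs G v \<inter> nbrs G u)) * (1 - x v))"
  using x_le_1 by (intro sum_nonneg) auto

lemma no_edge_outside:
  assumes "card {e \<in> edges G. e \<subseteq> W u} = 0" "v \<in> W u"
  shows "nbrs G v \<subseteq> nbrs G u"
proof
  fix w assume w: "w \<in> nbrs G v"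
  have "finite {e \<in> edges G. e \<subseteq> W u}" using finite_edges[OF G] by simp
  then have none: "{e \<in> edges G. e \<subseteq> W u} = {}" using assms(1) by simp
  show "w \<in> nbrs G u"
  proof (rule ccontr)
    assume "w \<notin> nbrs G u"
    moreover have "w \<noteq> u" using w assms(2) nbrs_commute[of w G v] by auto
    ultimately have "w \<in> W u" using nbrs_in_verts[OF G w] by auto
    then have "{v, w} \<in> {e \<in> edges G. e \<subseteq> W u}" using w assms(2) by (auto simp: nbrs_def)
    then show False using none by auto
  qed
qed

text \<open>
  Writing \<open>T = x a + x b + x c\<close>, \<open>S = \<Sum>v\<in>W. d\<^sub>N(v)\<close> and \<open>P = \<Sum>v\<in>W. d\<^sub>N(v) x v\<close>, the local
  inequality reads \<open>\<lambda> + 2 + S - P \<le> 2 T\<close>. It gives \<open>x \<le> 1/2\<close> on \<open>W\<close>, hence \<open>S \<le> 1\<close> and \<open>\<lambda> P \<le> S\<close>;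
  with the eigenvalue equations at \<open>a, b, c\<close>, that is \<open>\<lambda> T \<le> 3 + 2 T + P\<close>, this yields \<open>\<lambda>\<^sup>2 \<le> 10\<close>.
\<close>

lemma no_triangle_in_nbrs:
  assumes u: "u \<in> verts G" "x u = 1"
    and abc: "a \<in> nbrs G u" "b \<in> nbrs G u" "c \<in> nbrs G u"
    and adj: "b \<in> nbrs G a" "c \<in> nbrs G a" "c \<in> nbrs G b"
  shows False
proof -
  define I where "I = nbrs G u - {a, b, c}"
  define T where "T = x a + x b + x c"
  define d where "d v = card (nbrs G v \<inter> nbrs G u)" for v
  define P where "P = (\<Sum>v\<in>W u. real (d v) * x v)"
  define S where "S = (\<Sum>v\<in>W u. d v)"
  have ne: "a \<noteq> b" "a \<noteq> c" "b \<noteq> c" using adj not_in_nbrs_self[OF G] by auto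
  have adj': "a \<in> nbrs G b" "a \<in> nbrs G c" "b \<in> nbrs G c"
    using adj nbrs_commute by metis+
  \<comment> \<open>An edge inside the neighbourhood meets all three sides of the triangle, hence
    has both ends in it.\<close>
  have inner: "w \<in> {a, b, c} \<and> z \<in> {a, b, c}"
    if "w \<in> nbrs G u" "z \<in> nbrs G u" "z \<in> nbrs G w" for w z
  proof -
    have "w \<noteq> z" using that not_in_nbrs_self[OF G] by auto
    moreover have "{a, b} \<inter> {w, z} \<noteq> {}" "{a, c} \<inter> {w, z} \<noteq> {}" "{b, c} \<inter> {w, z} \<noteq> {}"
      using disjoint_edges abc adj that by blast+
    ultimately show ?thesis using ne by auto
  qed
  have Na: "nbrs G a \<inter> nbrs G u = {b, c}" "nbrs G b \<inter> nbrs G u = {a, c}" "nbrs G c \<inter> nbrs G u = {a, b}"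
    using inner abc adj adj' not_in_nbrs_self[OF G] by blast+
  have NI: "nbrs G w \<inter> nbrs G u = {}" if "w \<in> I" for w
    using inner that unfolding I_def by blast
  have Nu: "nbrs G u = {a, b, c} \<union> I" using abc by (auto simp: I_def)
  have split: "(\<Sum>w\<in>nbrs G u. g w) = g a + g b + g c + (\<Sum>w\<in>I. g w)" for g :: "'a \<Rightarrow> real"
  proof -
    have "(\<Sum>w\<in>nbrs G u. g w) = (\<Sum>w\<in>{a, b, c}. g w) + (\<Sum>w\<in>I. g w)"
      unfolding Nu using fin by (intro sum.union_disjoint) (auto simp: I_def)
    then show ?thesis using ne by simp
  qed
  have lam: "lam = T + (\<Sum>w\<in>I. x w)" using eig[OF u(1)] u(2) split[of x] by (simp add: T_def)
  have "(\<Sum>w\<in>nbrs G u. \<Sum>z\<in>nbrs G w \<inter> nbrs G u. x z) = 2 * T"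
    unfolding split[of "\<lambda>w. \<Sum>z\<in>nbrs G w \<inter> nbrs G u. x z"] Na using ne NI by (simp add: T_def)
  moreover have "3 \<le> card {e \<in> edges G. e \<subseteq> nbrs G u}"
  proof -
    have "card {{a, b}, {a, c}, {b, c}} = 3"
      using ne by (auto simp: card_insert_if doubleton_eq_iff)
    moreover have "{{a, b}, {a, c}, {b, c}} \<subseteq> {e \<in> edges G. e \<subseteq> nbrs G u}"
      using abc adj by (auto simp: nbrs_def)
    ultimately show ?thesis
      using card_mono[of "{e \<in> edges G. e \<subseteq> nbrs G u}" "{{a, b}, {a, c}, {b, c}}"]
        finite_edges[OF G] by simp
  qed
  moreover have SP: "(\<Sum>v\<in>W u. real (d v) * (1 - x v)) = real S - P"
    by (simp add: S_def P_def algebra_simps sum_subtractf)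
  ultimately have main: "lam + 2 + real (card {e \<in> edges G. e \<subseteq> W u}) + (real S - P) \<le> 2 * T"
    using local_inequality[OF u] unfolding d_def by linarith
  \<comment> \<open>With \<open>T \<le> 3\<close>, \<open>P \<le> S\<close> and
    \<open>lam > 3\<close>, \<open>main\<close> leaves less than one unit for the number of edges
    inside \<open>W u\<close>.\<close>
  have "T \<le> 3" unfolding T_def using abc[THEN x_nbr_le_1] by simp
  moreover have PS: "P \<le> real S" using SP deficiency_nonneg[of u] by (simp add: d_def)
  ultimately have "real (card {e \<in> edges G. e \<subseteq> W u}) < 1" using main lam_gt_3 by linarith
  then have W0: "card {e \<in> edges G. e \<subseteq> W u} = 0" by simp
  have Nv: "nbrs G v \<subseteq> nbrs G u" if "v \<in> W u" for v
    using no_edge_outside[OF W0 that] .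
  have half: "x v \<le> 1 / 2" if v: "v \<in> W u" for v
  proof -
    \<comment> \<open>If \<open>v\<close> were adjacent to both \<open>p\<close> and
      \<open>q\<close>, the triangles \<open>p u r\<close> and \<open>p q v\<close> would share only
      \<open>p\<close>.\<close>
    have at_most_one: "\<not> (p \<in> nbrs G v \<and> q \<in> nbrs G v)"
      if "q \<in> nbrs G p" "r \<in> nbrs G p" "p \<in> nbrs G u" "q \<in> nbrs G u" "r \<in> nbrs G u" "q \<noteq> r" for p q r
    proof
      assume "p \<in> nbrs G v \<and> q \<in> nbrs G v"
      then have "v \<in> nbrs G p" "v \<in> nbrs G q" "u \<in> nbrs G p"
        using that nbrs_commute[of _ G v] nbrs_commute[of _ G u] by auto
      then have "{u, r} \<inter> {q, v} \<noteq> {}"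
        using disjoint_edges[of u p r q v] that by simp
      then show False using that v not_in_nbrs_self[OF G] by auto
    qed
    have "\<not> (a \<in> nbrs G v \<and> b \<in> nbrs G v)" "\<not> (a \<in> nbrs G v \<and> c \<in> nbrs G v)"
      "\<not> (b \<in> nbrs G v \<and> c \<in> nbrs G v)"
      using at_most_one[of b a c] at_most_one[of c a b] at_most_one[of c b a] abc adj adj' ne by auto
    then consider "nbrs G v \<inter> {a, b, c} = {}" | p where "p \<in> {a, b, c}" "nbrs G v \<inter> {a, b, c} = {p}"
      by blast
    then have le1: "(\<Sum>z\<in>nbrs G v \<inter> {a, b, c}. x z) \<le> 1"
      by cases (use abc[THEN x_nbr_le_1] in auto)
    have "lam * x v = (\<Sum>z\<in>(nbrs G v \<inter> {a, b, c}) \<union> (nbrs G v \<inter> I). x z)"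
    proof -
      have "nbrs G v = (nbrs G v \<inter> {a, b, c}) \<union> (nbrs G v \<inter> I)" using Nv[OF v] Nu by auto
      then show ?thesis using eig[of v] v by auto
    qed
    also have "\<dots> = (\<Sum>z\<in>nbrs G v \<inter> {a, b, c}. x z) + (\<Sum>z\<in>nbrs G v \<inter> I. x z)"
      using fin by (intro sum.union_disjoint) (auto simp: I_def)
    also have "(\<Sum>z\<in>nbrs G v \<inter> I. x z) \<le> (\<Sum>z\<in>I. x z)"
      using fin x_nonneg by (intro sum_mono2) (auto simp: I_def)
    \<comment> \<open>The bound so far is \<open>1 + (lam - T)\<close>, and \<open>main\<close>
      gives \<open>T \<ge> lam / 2 + 1\<close>.\<close>
    finally have "lam * x v \<le> lam * (1 / 2)" using le1 main lam PS by linarith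
    then show ?thesis using lam_pos by simp
  qed
  \<comment> \<open>By \<open>half\<close>, \<open>S - P \<ge> S / 2\<close>, while
    \<open>main\<close> bounds \<open>S - P\<close> by \<open>4 - lam < 1\<close>. Hence the integer
    \<open>S\<close> is at most 1.\<close>
  have "(\<Sum>v\<in>W u. real (d v) * (1 / 2)) \<le> (\<Sum>v\<in>W u. real (d v) * (1 - x v))"
    by (intro sum_mono mult_left_mono) (use half in force)+
  then have "real S / 2 \<le> real S - P" using SP by (simp add: S_def sum_divide_distrib[symmetric])
  then have "real S < 2" using main \<open>T \<le> 3\<close> lam_gt_3 by linarith
  then have "S \<le> 1" by simp
  have "lam * P = (\<Sum>v\<in>W u. real (d v) * (lam * x v))"
    unfolding P_def by (simp add: sum_distrib_left algebra_simps)
  also have "\<dots> \<le> (\<Sum>v\<in>W u. real (d v))"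
  proof (rule sum_mono)
    fix v assume v: "v \<in> W u"
    have "d v \<le> S" unfolding S_def by (rule member_le_sum) (use v fin in auto)
    then have "d v \<le> 1" using \<open>S \<le> 1\<close> by simp
    have "lam * x v = (\<Sum>z\<in>nbrs G v. x z)" using eig v by auto
    also have "\<dots> \<le> (\<Sum>z\<in>nbrs G v. 1)" using x_nbr_le_1 by (intro sum_mono) auto
    also have "\<dots> = real (d v)" using Nv[OF v] by (simp add: d_def Int_absorb2)
    finally have "lam * x v \<le> 1" using \<open>d v \<le> 1\<close> by linarith
    then show "real (d v) * (lam * x v) \<le> real (d v)" by (simp add: mult_left_le)
  qed
  finally have lamP: "lam * P \<le> real S" by (simp add: S_def)
  have "lam * x a = 1 + x b + x c + (\<Sum>z\<in>nbrs G a \<inter> W u. x z)"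
    "lam * x b = 1 + x a + x c + (\<Sum>z\<in>nbrs G b \<inter> W u. x z)"
    "lam * x c = 1 + x a + x b + (\<Sum>z\<in>nbrs G c \<inter> W u. x z)"
    using abc[THEN nbrs_partition] eig abc nbrs_in_verts[OF G] u(2) ne by (simp_all add: Na)
  moreover have "(\<Sum>z\<in>nbrs G a \<inter> W u. x z) + (\<Sum>z\<in>nbrs G b \<inter> W u. x z) + (\<Sum>z\<in>nbrs G c \<inter> W u. x z) \<le> P"
  proof -
    \<comment> \<open>Edges from \<open>I\<close> to \<open>W u\<close> contribute nonnegatively to
      \<open>P\<close>, so they may be dropped.\<close>
    have "0 \<le> (\<Sum>w\<in>I. \<Sum>z\<in>nbrs G w \<inter> W u. x z)" using x_nonneg by (intro sum_nonneg)
    then show ?thesis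
      using split[of "\<lambda>w. \<Sum>z\<in>nbrs G w \<inter> W u. x z"] sum_outer_swap[of u] by (simp add: P_def d_def)
  qed
  ultimately have "lam * T \<le> 3 + 2 * T + P" by (simp add: T_def algebra_simps)
  then have "(lam - 2) * (2 * T) \<le> 6 + 2 * P" by (simp add: algebra_simps)
  \<comment> \<open>Multiplying \<open>main\<close> by \<open>lam - 2\<close> bounds
    \<open>(lam - 2) (2 T)\<close> from below, to be chained with the upper bound
    \<open>6 + 2 P\<close>. Then \<open>lam P \<le> S\<close> removes \<open>P\<close> and leaves
    \<open>(lam - 3) S\<close>.\<close>
  moreover have "(lam - 2) * (lam + 2 + (real S - P)) \<le> (lam - 2) * (2 * T)"
    using main lam_gt_3 by (intro mult_left_mono) auto
  ultimately have "lam\<^sup>2 + (lam - 3) * real S \<le> 10"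
    using lamP by (simp add: algebra_simps power2_eq_square)
  moreover have "0 \<le> (lam - 3) * real S" using lam_gt_3 by simp
  ultimately show False using lam_sq_gt_10 by simp
qed

text \<open>Once triangles are excluded, the edges inside the neighbourhood form a star with centre
  \<open>c\<close> and leaf set \<open>L\<close>; let \<open>I\<close> be the remaining neighbours.
  The local inequality then bounds by 0 a sum of nonnegative terms:
  \<open>(card L - 1) (1 - x c)\<close>, the weight of \<open>I\<close>, the number of edges inside
  \<open>W u\<close>, and the deficiency \<open>D\<close>. Each term must vanish, which yields all
  the conclusions.\<close>

lemma star_neighbourhood:
  assumes u: "u \<in> verts G" "x u = 1"
  obtains c where "c \<in> nbrs G u" "x c = 1" "nbrs G u = insert c (nbrs G c \<inter> nbrs G u)"
    "3 \<le> card (nbrs G c \<inter> nbrs G u)"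
    "\<And>w. w \<in> nbrs G c \<inter> nbrs G u \<Longrightarrow> nbrs G w \<inter> nbrs G u = {c}"
    "\<And>v. v \<in> W u \<Longrightarrow> nbrs G v \<subseteq> nbrs G u"
    "\<And>v. v \<in> W u \<Longrightarrow> nbrs G v \<noteq> {} \<Longrightarrow> x v = 1"
proof -
  \<comment> \<open>Without an edge inside the neighbourhood the local inequality would give
    \<open>lam \<le> 1\<close>.\<close>
  have "\<exists>w\<in>nbrs G u. nbrs G w \<inter> nbrs G u \<noteq> {}"
  proof (rule ccontr)
    assume "\<not> ?thesis"
    then have "(\<Sum>w\<in>nbrs G u. \<Sum>z\<in>nbrs G w \<inter> nbrs G u. x z) = 0" by simp
    then show False using local_inequality[OF u] deficiency_nonneg[of u] lam_gt_3 by linarith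
  qed
  then obtain a b where ab: "a \<in> nbrs G u" "b \<in> nbrs G u" "b \<in> nbrs G a" by auto
  have "\<exists>c\<in>{a, b}. \<forall>w\<in>nbrs G u. \<forall>z\<in>nbrs G w \<inter> nbrs G u. w = c \<or> z = c"
  proof (rule ccontr)
    \<comment> \<open>If neither \<open>a\<close> nor \<open>b\<close> is a centre, some edge
      \<open>w z\<close> avoids \<open>a\<close> and some edge \<open>p q\<close> avoids
      \<open>b\<close>. As they meet \<open>a b\<close> and each other, they contain
      \<open>b\<close> and \<open>a\<close> respectively and share a third vertex \<open>r\<close>,
      closing a triangle.\<close>
    assume contra: "\<not> ?thesis"
    obtain w z where wz: "w \<in> nbrs G u" "z \<in> nbrs G u" "z \<in> nbrs G w" "w \<noteq> a" "z \<noteq> a"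
      using contra by blast
    obtain p q where pq: "p \<in> nbrs G u" "q \<in> nbrs G u" "q \<in> nbrs G p" "p \<noteq> b" "q \<noteq> b"
      using contra by blast
    have sym: "w \<in> nbrs G z" "p \<in> nbrs G q" using wz pq nbrs_commute by metis+
    have "{a, b} \<inter> {w, z} \<noteq> {}" "{a, b} \<inter> {p, q} \<noteq> {}" "{w, z} \<inter> {p, q} \<noteq> {}"
      using disjoint_edges ab wz pq by blast+
    then obtain r where "r \<in> nbrs G u" "r \<in> nbrs G b" "r \<in> nbrs G a"
      using wz pq sym by auto
    then show False using no_triangle_in_nbrs[OF u ab(1,2)] ab(3) by blast
  qed
  then obtain c where c: "c \<in> {a, b}"
    and star: "\<And>w z. w \<in> nbrs G u \<Longrightarrow> z \<in> nbrs G w \<Longrightarrow> z \<in> nbrs G u \<Longrightarrow> w = c \<or> z = c"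
    by blast
  have cu: "c \<in> nbrs G u" using c ab by auto
  define L where "L = nbrs G c \<inter> nbrs G u"
  define I where "I = nbrs G u - insert c L"
  define D where "D = (\<Sum>v\<in>W u. real (card (nbrs G v \<inter> nbrs G u)) * (1 - x v))"
  have fL: "finite L" "finite I" using fin by (auto simp: L_def I_def)
  have cL: "c \<notin> L" using not_in_nbrs_self[OF G] by (auto simp: L_def)
  have "L \<noteq> {}" using c ab nbrs_commute[of b G a] by (auto simp: L_def)
  then have k1: "1 \<le> card L" using fL by (simp add: Suc_le_eq card_gt_0_iff)
  have NL: "nbrs G w \<inter> nbrs G u = {c}" if "w \<in> L" for w
    using that star[of w] cL cu nbrs_commute[of w G c] by (auto simp: L_def)
  have NI: "nbrs G w \<inter> nbrs G u = {}" if "w \<in> I" for w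
    using that star[of w] nbrs_commute[of w G c] by (auto simp: L_def I_def)
  have split: "(\<Sum>w\<in>nbrs G u. g w) = g c + (\<Sum>w\<in>L. g w) + (\<Sum>w\<in>I. g w)" for g :: "'a \<Rightarrow> real"
  proof -
    have "nbrs G u = insert c L \<union> I" using cu by (auto simp: I_def L_def)
    then have "(\<Sum>w\<in>nbrs G u. g w) = (\<Sum>w\<in>insert c L. g w) + (\<Sum>w\<in>I. g w)"
      using fL by (simp only:) (intro sum.union_disjoint, auto simp: I_def)
    then show ?thesis using fL cL by simp
  qed
  have lam: "lam = x c + (\<Sum>w\<in>L. x w) + (\<Sum>w\<in>I. x w)" using eig[OF u(1)] u(2) split[of x] by simp
  have "(\<Sum>w\<in>nbrs G u. \<Sum>z\<in>nbrs G w \<inter> nbrs G u. x z) = (\<Sum>w\<in>L. x w) + real (card L) * x c"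
    unfolding split[of "\<lambda>w. \<Sum>z\<in>nbrs G w \<inter> nbrs G u. x z"] using NL NI by (simp add: L_def)
  moreover have "card L \<le> card {e \<in> edges G. e \<subseteq> nbrs G u}"
  proof -
    have "card ((\<lambda>l. {c, l}) ` L) = card L"
      by (rule card_image) (auto simp: inj_on_def doubleton_eq_iff)
    moreover have "(\<lambda>l. {c, l}) ` L \<subseteq> {e \<in> edges G. e \<subseteq> nbrs G u}"
      using cu by (auto simp: nbrs_def L_def)
    ultimately show ?thesis
      using card_mono[of "{e \<in> edges G. e \<subseteq> nbrs G u}" "(\<lambda>l. {c, l}) ` L"]
        finite_edges[OF G] by simp
  qed
  ultimately have main: "(real (card L) - 1) * (1 - x c) + (\<Sum>w\<in>I. x w)
      + real (card {e \<in> edges G. e \<subseteq> W u}) + D \<le> 0"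
    using local_inequality[OF u] lam by (simp add: D_def algebra_simps)
  have nonneg: "0 \<le> (real (card L) - 1) * (1 - x c)" "0 \<le> (\<Sum>w\<in>I. x w)" "0 \<le> D"
    using k1 x_nbr_le_1[OF cu] x_nonneg deficiency_nonneg[of u]
    by (auto simp: D_def intro: mult_nonneg_nonneg sum_nonneg)
  have zero: "(real (card L) - 1) * (1 - x c) = 0" "(\<Sum>w\<in>I. x w) = 0" "D = 0"
    "card {e \<in> edges G. e \<subseteq> W u} = 0"
    using main nonneg by linarith+
  \<comment> \<open>A vertex of \<open>I\<close> has value 0, but its neighbour \<open>u\<close> has
    value 1, contradicting the eigenvalue equation.\<close>
  have "I = {}"
  proof (rule ccontr)
    assume "I \<noteq> {}"
    then obtain w where w: "w \<in> I" by auto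
    then have "x w = 0" using zero(2) fL x_nonneg by (simp add: sum_nonneg_eq_0_iff)
    have "w \<in> nbrs G u" using w by (simp add: I_def)
    then have "u \<in> nbrs G w" "w \<in> verts G" using nbrs_commute nbrs_in_verts[OF G] by metis+
    then have "x u \<le> (\<Sum>z\<in>nbrs G w. x z)" using fin x_nonneg by (intro member_le_sum) auto
    then show False using eig[OF \<open>w \<in> verts G\<close>] \<open>x w = 0\<close> u(2) by simp
  qed
  \<comment> \<open>A vanishing product gives \<open>x c = 1\<close> only if \<open>card L\<close>
    is not 1; the bound \<open>lam > 3\<close> supplies this.\<close>
  have "(\<Sum>w\<in>L. x w) \<le> (\<Sum>w\<in>L. 1)" using x_nbr_le_1 by (intro sum_mono) (auto simp: L_def)
  then have "lam \<le> 1 + real (card L)" using lam \<open>I = {}\<close> x_nbr_le_1[OF cu] by simp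
  then have k3: "3 \<le> card L" using lam_gt_3 by simp
  show thesis
  proof (rule that[of c, folded L_def])
    show "c \<in> nbrs G u" by (rule cu)
    show "x c = 1" using zero(1) k3 by simp
    show "nbrs G u = insert c L" using \<open>I = {}\<close> cu by (auto simp: I_def L_def)
    show "3 \<le> card L" by (rule k3)
    show "nbrs G w \<inter> nbrs G u = {c}" if "w \<in> L" for w using NL[OF that] .
    show Nv: "nbrs G v \<subseteq> nbrs G u" if "v \<in> W u" for v
      using no_edge_outside[OF zero(4) that] .
    show "x v = 1" if "v \<in> W u" "nbrs G v \<noteq> {}" for v
    proof -
      have "\<forall>v\<in>W u. real (card (nbrs G v \<inter> nbrs G u)) * (1 - x v) = 0"
        using zero(3) fin x_le_1 unfolding D_def by (subst (asm) sum_nonneg_eq_0_iff) auto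
      then have "real (card (nbrs G v \<inter> nbrs G u)) * (1 - x v) = 0" using that by blast
      moreover have "nbrs G v \<inter> nbrs G u \<noteq> {}" using Nv[OF that(1)] that(2) by blast
      ultimately show ?thesis using fin by auto
    qed
  qed
qed

text \<open>The star lemma is applied at \<open>u\<close>, then at \<open>c\<close>, and finally at
  any non-isolated vertex of \<open>W u\<close>, since all of these have value 1.\<close>

lemma edges_eq_book:
  assumes u: "u \<in> verts G" "x u = 1"
  obtains c L where "finite L" "u \<noteq> c" "u \<notin> L" "c \<notin> L" "edges G = book u c L"
    "lam\<^sup>2 = lam + 2 * real (card L)"
proof -
  obtain c where cu: "c \<in> nbrs G u" "x c = 1"
    and Nu: "nbrs G u = insert c (nbrs G c \<inter> nbrs G u)"
    and k3: "3 \<le> card (nbrs G c \<inter> nbrs G u)"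
    and NL: "\<And>w. w \<in> nbrs G c \<inter> nbrs G u \<Longrightarrow> nbrs G w \<inter> nbrs G u = {c}"
    and NW: "\<And>v. v \<in> W u \<Longrightarrow> nbrs G v \<subseteq> nbrs G u"
    and xW: "\<And>v. v \<in> W u \<Longrightarrow> nbrs G v \<noteq> {} \<Longrightarrow> x v = 1"
    using star_neighbourhood[OF u] by metis
  define L where "L = nbrs G c \<inter> nbrs G u"
  have cV: "c \<in> verts G" using nbrs_in_verts[OF G cu(1)] by simp
  have uc: "u \<in> nbrs G c" using cu nbrs_commute by metis
  have cL: "c \<notin> L" "u \<notin> L" "u \<noteq> c" using not_in_nbrs_self[OF G] cu by (auto simp: L_def)
  obtain c' where c': "c' \<in> nbrs G c" "nbrs G c = insert c' (nbrs G c' \<inter> nbrs G c)"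
      "\<And>w. w \<in> nbrs G c' \<inter> nbrs G c \<Longrightarrow> nbrs G w \<inter> nbrs G c = {c'}"
    using star_neighbourhood[OF cV cu(2)] by metis
  \<comment> \<open>Otherwise \<open>u\<close> is a leaf of the star around \<open>c'\<close> and
    has a single neighbour in \<open>nbrs G c\<close>, yet it has at least three there.\<close>
  have "c' = u"
  proof (rule ccontr)
    assume "c' \<noteq> u"
    then have "u \<in> nbrs G c' \<inter> nbrs G c" using uc c'(2) by (metis insert_iff)
    then have "nbrs G u \<inter> nbrs G c = {c'}" by (rule c'(3))
    then show False using k3 by (simp add: Int_commute)
  qed
  then have Nc: "nbrs G c = insert u L" unfolding L_def using c'(2) by (metis Int_commute)
  have Nu': "nbrs G u = insert c L" unfolding L_def by (rule Nu)
  \<comment> \<open>A non-isolated \<open>v\<close> would have an edge \<open>d w\<close> inside its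
    neighbourhood. That neighbourhood lies in \<open>L\<close>, which is independent because its
    vertices see only \<open>c\<close> inside \<open>nbrs G u\<close>.\<close>
  have isolated: "nbrs G v = {}" if v: "v \<in> W u" for v
  proof (rule ccontr)
    assume ne: "nbrs G v \<noteq> {}"
    have "v \<in> verts G" using v by auto
    then obtain d where d: "d \<in> nbrs G v" "3 \<le> card (nbrs G d \<inter> nbrs G v)"
      using star_neighbourhood[OF _ xW[OF v ne]] by metis
    then have "nbrs G d \<inter> nbrs G v \<noteq> {}" by auto
    then obtain w where w: "w \<in> nbrs G d" "w \<in> nbrs G v" by auto
    have "c \<notin> nbrs G v" using v Nc Nu' nbrs_commute[of c G v] by auto
    then have "nbrs G v \<subseteq> L" using NW[OF v] Nu' by auto
    then have "d \<in> L" "w \<in> L" using d w by auto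
    then have "w \<in> nbrs G d \<inter> nbrs G u" using w by (auto simp: L_def)
    moreover have "nbrs G d \<inter> nbrs G u = {c}"
      using NL[of d] \<open>d \<in> L\<close> by (simp add: L_def)
    ultimately show False using \<open>w \<in> L\<close> cL by auto
  qed
  have Nl: "nbrs G l = {u, c}" if l: "l \<in> L" for l
  proof -
    have "l \<in> nbrs G u" "l \<in> nbrs G c" using l by (auto simp: L_def)
    then have "u \<in> nbrs G l" "c \<in> nbrs G l" using nbrs_commute by metis+
    moreover have "z = u \<or> z = c" if z: "z \<in> nbrs G l" for z
    proof -
      have "l \<in> nbrs G z" using z nbrs_commute by metis
      then have "z \<notin> W u" using isolated by auto
      then have "z = u \<or> z \<in> nbrs G u" using nbrs_in_verts[OF G z] by auto
      then show ?thesis using NL[of l] l z by (auto simp: L_def)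
    qed
    ultimately show ?thesis by auto
  qed
  have "edges G = book u c L"
  proof
    show "edges G \<subseteq> book u c L"
    proof
      fix e assume "e \<in> edges G"
      then obtain v w where e: "e = {v, w}" "w \<in> nbrs G v" by (rule edge_cases[OF G])
      have "v \<notin> W u" using isolated e by auto
      then consider "v = u" | "v = c" | "v \<in> L" using nbrs_in_verts[OF G e(2)] Nu' by auto
      then show "e \<in> book u c L"
        by cases (use e Nu' Nc Nl in \<open>auto simp: book_def insert_commute\<close>)
    qed
    show "book u c L \<subseteq> edges G"
      using cu Nu' Nc by (auto simp: book_def nbrs_def)
  qed
  moreover have fL: "finite L" using fin by (simp add: L_def)
  moreover have "lam\<^sup>2 = lam + 2 * real (card L)"
  proof -
    have "lam = 1 + (\<Sum>l\<in>L. x l)" using eig[OF u(1)] u(2) cu(2) fL cL by (simp add: Nu')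
    then have "lam * lam = lam + (\<Sum>l\<in>L. lam * x l)"
      by (metis distrib_left mult.right_neutral sum_distrib_left)
    moreover have "lam * x l = 2" if "l \<in> L" for l
    proof -
      have "l \<in> verts G" using that nbrs_in_verts[OF G, of l u] by (simp add: L_def)
      then show ?thesis using eig[of l] Nl[OF that] u(2) cu(2) cL by simp
    qed
    ultimately show ?thesis by (simp add: power2_eq_square)
  qed
  ultimately show thesis using that cL by blast
qed

end

section \<open>The size of a book and the use of bowtie-freeness\<close>

lemma card_book:
  assumes "finite L" "u \<noteq> c" "u \<notin> L" "c \<notin> L"
  shows "card (book u c L) = 2 * card L + 1"
proof -
  have "card ((\<lambda>l. {u, l}) ` L \<union> (\<lambda>l. {c, l}) ` L) = card ((\<lambda>l. {u, l}) ` L) + card ((\<lambda>l. {c, l}) ` L)"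
    using assms by (intro card_Un_disjoint) (auto simp: doubleton_eq_iff)
  also have "\<dots> = card L + card L"
    by (intro arg_cong2[where f = "(+)"] card_image) (auto simp: inj_on_def doubleton_eq_iff)
  moreover have "{u, c} \<notin> (\<lambda>l. {u, l}) ` L \<union> (\<lambda>l. {c, l}) ` L"
    using assms by (auto simp: doubleton_eq_iff)
  ultimately show ?thesis using assms by (simp add: book_def)
qed

text \<open>Two triangles at \<open>p\<close> with disjoint opposite edges span five distinct
  vertices. Subgraphs need not be induced, so \<open>H\<close> keeps exactly the six triangle edges,
  whatever else \<open>G\<close> contains.\<close>

lemma graph_free_bowtieD:
  assumes G: "simple_graph G" and free: "graph_free bowtie G"
    and adj: "a \<in> nbrs G p" "b \<in> nbrs G p" "b \<in> nbrs G a"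
      "c \<in> nbrs G p" "d \<in> nbrs G p" "d \<in> nbrs G c"
  shows "{a, b} \<inter> {c, d} \<noteq> {}"
proof
  assume disj: "{a, b} \<inter> {c, d} = {}"
  have ne: "a \<noteq> p" "b \<noteq> p" "c \<noteq> p" "d \<noteq> p" "a \<noteq> b" "c \<noteq> d" "a \<noteq> c" "a \<noteq> d" "b \<noteq> c" "b \<noteq> d"
    using adj not_in_nbrs_self[OF G] disj by auto
  define H where "H = \<lparr>verts = {p, a, b, c, d}, edges = {{p, a}, {p, b}, {a, b}, {p, c}, {p, d}, {c, d}}\<rparr>"
  have "subgraph_of H G"
    using adj ne nbrs_in_verts[OF G]
    by (auto simp: subgraph_of_def H_def simple_graph_def nbrs_def)
  moreover have "graph_isomorphic H bowtie"
  proof -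
    define f where "f v = (if v = p then 0 else if v = a then 1 else if v = b then 2 else if v = c then 3 else (4::nat))" for v
    have f: "f p = 0" "f a = 1" "f b = 2" "f c = 3" "f d = 4"
      using ne by (auto simp: f_def)
    have "bij_betw f (verts H) (verts bowtie)"
      using f by (auto simp: bij_betw_def inj_on_def H_def bowtie_def)
    moreover have "\<forall>v\<in>verts H. \<forall>w\<in>verts H. {v, w} \<in> edges H \<longleftrightarrow> {f v, f w} \<in> edges bowtie"
      using ne ne[symmetric] by (simp add: H_def bowtie_def f doubleton_eq_iff)
    ultimately show ?thesis unfolding graph_isomorphic_def by blast
  qed
  ultimately show False using free by (auto simp: graph_free_def)
qed

subsection \<open>The join of an edge and an edgeless graph\<close>

abbreviation book_graph :: "nat \<Rightarrow> (nat + nat) sgraph" where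
  "book_graph k \<equiv> graph_join (complete_graph 2) (edgeless_graph k)"

lemma edges_complete_graph_2: "edges (complete_graph 2) = {{0, 1}}"
proof -
  have "{..<2::nat} = {0, 1}" by auto
  then show ?thesis
    by (auto simp: complete_graph_def card_2_iff doubleton_eq_iff)
qed

lemma verts_book_graph: "verts (book_graph k) = {Inl 0, Inl 1} \<union> Inr ` {..<k}"
proof -
  have "{..<2::nat} = {0, 1}" by auto
  then show ?thesis by (auto simp: graph_join_def complete_graph_def edgeless_graph_def)
qed

lemma edges_book_graph: "edges (book_graph k) = book (Inl 0) (Inl 1) (Inr ` {..<k})"
proof -
  have "verts (complete_graph 2) = {0, 1}" by (auto simp: complete_graph_def)
  moreover have "edges (edgeless_graph k) = {}" "verts (edgeless_graph k) = {..<k}"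
    by (simp_all add: edgeless_graph_def)
  ultimately show ?thesis
    by (auto simp: graph_join_def edges_complete_graph_2 book_def)
qed

lemma remove_isolated_book_graph: "remove_isolated (book_graph k) = book_graph k"
proof -
  have "{v \<in> verts (book_graph k). \<exists>e\<in>edges (book_graph k). v \<in> e} = verts (book_graph k)"
    by (auto simp: verts_book_graph edges_book_graph book_def)
  then show ?thesis by (simp add: remove_isolated_def)
qed

section \<open>Removing isolated vertices and recognising the extremal graph\<close>

lemma edges_remove_isolated [simp]: "edges (remove_isolated G) = edges G"
  by (simp add: remove_isolated_def)

lemma nbrs_remove_isolated [simp]: "nbrs (remove_isolated G) v = nbrs G v"
  by (simp add: nbrs_def)

lemma simple_graph_remove_isolated: "simple_graph G \<Longrightarrow> simple_graph (remove_isolated G)"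
  by (auto simp: simple_graph_def remove_isolated_def)

lemma mem_verts_remove_isolated:
  assumes "simple_graph G"
  shows "v \<in> verts (remove_isolated G) \<longleftrightarrow> nbrs G v \<noteq> {}"
proof
  assume "v \<in> verts (remove_isolated G)"
  then obtain e where e: "e \<in> edges G" "v \<in> e" by (auto simp: remove_isolated_def)
  then obtain p q where "e = {p, q}" "q \<in> nbrs G p" using edge_cases[OF assms] by metis
  then show "nbrs G v \<noteq> {}" using e(2) nbrs_commute[of q G p] by auto
next
  assume "nbrs G v \<noteq> {}"
  then obtain w where w: "w \<in> nbrs G v" by auto
  then show "v \<in> verts (remove_isolated G)"
    using nbrs_in_verts[OF assms w] by (auto simp: remove_isolated_def nbrs_def)
qed

text \<open>The non-isolated vertices are \<open>u\<close>, \<open>c\<close> and \<open>L\<close>.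
  The isomorphism sends \<open>u\<close> and \<open>c\<close> to the ends of the edge and numbers
  \<open>L\<close> arbitrarily.\<close>

lemma equal_up_to_isolated_book:
  assumes G: "simple_graph G" and E: "edges G = book u c L"
    and L: "finite L" "u \<noteq> c" "u \<notin> L" "c \<notin> L"
  shows "equal_up_to_isolated G (book_graph (card L))"
proof -
  define k where "k = card L"
  have V: "verts (remove_isolated G) = {u, c} \<union> L"
  proof -
    have "verts (remove_isolated G) = \<Union> (edges G)"
      using G unfolding simple_graph_def remove_isolated_def by fastforce
    also have "\<dots> = {u, c} \<union> L" unfolding E by (auto simp: book_def)
    finally show ?thesis .
  qed
  have "\<exists>h. bij_betw h L {..<k}"
    using ex_bij_betw_finite_nat[OF L(1)] unfolding k_def lessThan_atLeast0 .
  then obtain h where h: "bij_betw h L {..<k}" ..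
  define f :: "'a \<Rightarrow> nat + nat" where
    "f v = (if v = u then Inl 0 else if v = c then Inl 1 else Inr (h v))" for v
  have f: "f u = Inl 0" "f c = Inl 1" using L by (auto simp: f_def)
  have fL: "f v = Inr (h v)" if "v \<in> L" for v using that L by (auto simp: f_def)
  have hL: "h v < k" if "v \<in> L" for v using h that by (auto simp: bij_betw_def)
  have "bij_betw f ({u, c} \<union> L) ({Inl 0, Inl 1} \<union> Inr ` {..<k})"
  proof (rule bij_betw_combine)
    show "bij_betw f {u, c} {Inl 0, Inl 1}"
      using f L(2) by (auto simp: bij_betw_def inj_on_def)
    have "f ` L = Inr ` h ` L" using fL by force
    moreover have "inj_on f L" using h fL by (auto simp: bij_betw_def inj_on_def)
    ultimately show "bij_betw f L (Inr ` {..<k})" using h by (simp add: bij_betw_def)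
  qed auto
  moreover have "{v, w} \<in> edges G \<longleftrightarrow> {f v, f w} \<in> edges (book_graph k)"
    if "v \<in> {u, c} \<union> L" "w \<in> {u, c} \<union> L" for v w
    unfolding E edges_book_graph using that L
    by (auto simp: book_def doubleton_eq_iff f fL hL image_iff)
  ultimately show ?thesis
    unfolding equal_up_to_isolated_def graph_isomorphic_def remove_isolated_book_graph
    using V by (auto simp: verts_book_graph k_def)
qed

lemma simple_graph_book_graph: "simple_graph (book_graph k)"
proof -
  have "finite (verts (book_graph k))" by (simp add: verts_book_graph)
  moreover have "e \<subseteq> verts (book_graph k) \<and> card e = 2" if "e \<in> edges (book_graph k)" for e
    using that unfolding verts_book_graph edges_book_graph book_def by fastforce
  ultimately show ?thesis by (simp add: simple_graph_def)
qed

text \<open>The function is constant on each side of the join. At an end of the edge the equation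
  reads \<open>lam + 2 k = lam\<^sup>2\<close>, at the other vertices
  \<open>2 lam = lam * 2\<close>.\<close>

lemma eigenfunction_book_graph:
  assumes lam: "lam\<^sup>2 = lam + 2 * real k" and "lam \<noteq> 0"
  shows "eigenfunction (book_graph k) lam (case_sum (\<lambda>_. lam) (\<lambda>_. 2))"
proof -
  have "nbrs (book_graph k) (Inl 0) = insert (Inl 1) (Inr ` {..<k})"
    "nbrs (book_graph k) (Inl 1) = insert (Inl 0) (Inr ` {..<k})"
    "i < k \<Longrightarrow> nbrs (book_graph k) (Inr i) = {Inl 0, Inl 1}" for i
    by (auto simp: nbrs_def edges_book_graph book_def doubleton_eq_iff image_iff)
  moreover have "(\<Sum>w\<in>Inr ` {..<k}. case_sum (\<lambda>_. lam) (\<lambda>_. 2) w) = 2 * real k"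
    by (subst sum.reindex) auto
  moreover have "Inl i \<notin> Inr ` {..<k}" for i :: nat by auto
  ultimately show ?thesis
    using assms by (auto simp: eigenfunction_def verts_book_graph power2_eq_square)
qed

section \<open>Transport of eigenfunctions along isomorphisms and past isolated vertices\<close>

lemma graph_isomorphic_eigenfunction:
  assumes "simple_graph G" "simple_graph H"
    and iso: "graph_isomorphic G H" and ev: "eigenfunction H k g"
  obtains f where "eigenfunction G k f"
proof -
  obtain \<phi> where bij: "bij_betw \<phi> (verts G) (verts H)"
    and adj: "\<And>v w. v \<in> verts G \<Longrightarrow> w \<in> verts G \<Longrightarrow> {v, w} \<in> edges G \<longleftrightarrow> {\<phi> v, \<phi> w} \<in> edges H"
    using iso by (auto simp: graph_isomorphic_def)
  have "(\<Sum>w\<in>nbrs G v. g (\<phi> w)) = k * g (\<phi> v)" if v: "v \<in> verts G" for v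
  proof -
    have "(\<Sum>w\<in>nbrs G v. g (\<phi> w))
        = (\<Sum>w\<in>verts G. (if {\<phi> v, \<phi> w} \<in> edges H then 1 else 0) * g (\<phi> w))"
      unfolding sum_nbrs[OF assms(1), symmetric] using adj v by (intro sum.cong) auto
    also have "\<dots> = (\<Sum>w\<in>verts H. (if {\<phi> v, w} \<in> edges H then 1 else 0) * g w)"
      by (rule sum.reindex_bij_betw[OF bij])
    also have "\<dots> = (\<Sum>w\<in>nbrs H (\<phi> v). g w)" by (rule sum_nbrs[OF assms(2)])
    finally show ?thesis
      using ev bij_betwE[OF bij] v by (simp add: eigenfunction_def)
  qed
  moreover have "\<exists>v\<in>verts G. g (\<phi> v) \<noteq> 0"
  proof -
    obtain w where "w \<in> verts H" "g w \<noteq> 0" using ev by (auto simp: eigenfunction_def)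
    then show ?thesis using bij_betw_imp_surj_on[OF bij] by force
  qed
  ultimately have "eigenfunction G k (g \<circ> \<phi>)" by (simp add: eigenfunction_def)
  then show thesis by (rule that)
qed

text \<open>At an isolated vertex the neighbour sum is empty, so the value 0 satisfies the equation
  for every \<open>k\<close>.\<close>

lemma remove_isolated_eigenfunction:
  assumes G: "simple_graph G" and ev: "eigenfunction (remove_isolated G) k f"
  shows "eigenfunction G k (\<lambda>v. if v \<in> verts (remove_isolated G) then f v else 0)"
proof -
  let ?R = "remove_isolated G"
  have sub: "verts ?R \<subseteq> verts G" by (auto simp: remove_isolated_def)
  have "nbrs G v \<subseteq> verts ?R" for v
    using nbrs_subset_verts[OF simple_graph_remove_isolated[OF G]] by simp
  then have "(\<Sum>w\<in>nbrs G v. if w \<in> verts ?R then f w else 0) = (\<Sum>w\<in>nbrs G v. f w)" for v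
    by (intro sum.cong) auto
  moreover have "(\<Sum>w\<in>nbrs G v. f w) = 0" if "v \<notin> verts ?R" for v
    using mem_verts_remove_isolated[OF G] that by simp
  ultimately show ?thesis
    using ev sub by (auto simp: eigenfunction_def)
qed

subsection \<open>The spectral bound\<close>

theorem theorem1p9:
  fixes G :: "'a sgraph" and m :: nat
  assumes "m \<ge> 8"
    and "simple_graph G"
    and "graph_free bowtie G"
    and "card (edges G) = m"
  shows "largest_eigenvalue G \<le> (1 + sqrt (4 * real m - 3)) / 2
    \<and> (largest_eigenvalue G = (1 + sqrt (4 * real m - 3)) / 2 \<longleftrightarrow>
        odd m \<and>
        equal_up_to_isolated G (graph_join (complete_graph 2) (edgeless_graph ((m - 1) div 2))))"
proof -
  define \<rho> where "\<rho> = (1 + sqrt (4 * real m - 3)) / 2"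
  define lam where "lam = largest_eigenvalue G"
  have m: "m \<ge> 8" and G: "simple_graph G" and E: "card (edges G) = m"
    using assms by auto
  \<comment> \<open>\<open>\<rho>\<close> is the larger root of
    \<open>t\<^sup>2 - t = m - 1\<close>, the form in which the bound is used.\<close>
  have \<rho>_sq: "\<rho>\<^sup>2 - \<rho> = real m - 1"
    using m by (simp add: \<rho>_def power2_eq_square field_simps)
  have \<rho>_gt: "1 < \<rho>" using m real_less_rsqrt[of 1 "4 * real m - 3"] by (simp add: \<rho>_def)
  have book: "\<exists>u c L. finite L \<and> u \<noteq> c \<and> u \<notin> L \<and> c \<notin> L \<and> edges G = book u c L
      \<and> lam\<^sup>2 = lam + 2 * real (card L)"
    if big: "\<rho> \<le> lam"
  proof -
    have "edges G \<noteq> {}" using E m by auto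
    then have "verts G \<noteq> {}" using edge_cases[OF G] nbrs_in_verts[OF G] by (metis ex_in_conv)
    then obtain f where ev: "eigenfunction G lam f" and f0: "\<And>v. 0 \<le> f v"
      using perron_eigenfunction[OF G] unfolding lam_def by metis
    have fin: "finite (verts G)" using G by (simp add: simple_graph_def)
    define M where "M = Max (f ` verts G)"
    have "M \<in> f ` verts G" unfolding M_def using fin \<open>verts G \<noteq> {}\<close> by (intro Max_in) auto
    then obtain u where u: "u \<in> verts G" "f u = M" by auto
    have M: "f v \<le> M" if "v \<in> verts G" for v unfolding M_def using fin that by (intro Max_ge) auto
    obtain v0 where v0: "v0 \<in> verts G" "f v0 \<noteq> 0" using ev by (auto simp: eigenfunction_def)
    have "M > 0" using M[OF v0(1)] f0[of v0] v0(2) by linarith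
    define x where "x v = f v / M" for v
    \<comment> \<open>The map \<open>t (t - 1)\<close> is increasing for
      \<open>t \<ge> 1\<close>.\<close>
    have "\<rho> * (\<rho> - 1) \<le> lam * (lam - 1)" using big \<rho>_gt by (intro mult_mono) auto
    then have lam: "real m - 1 \<le> lam\<^sup>2 - lam" using \<rho>_sq by (simp add: power2_eq_square algebra_simps)
    interpret extremal_eigenfunction G x lam
    proof
      show "simple_graph G" by (rule G)
      show "{a, b} \<inter> {c, d} \<noteq> {}"
        if "a \<in> nbrs G p" "b \<in> nbrs G p" "b \<in> nbrs G a" "c \<in> nbrs G p" "d \<in> nbrs G p" "d \<in> nbrs G c"
        for p a b c d
        using graph_free_bowtieD[OF G assms(3) that] .
      show "(\<Sum>w\<in>nbrs G v. x w) = lam * x v" if "v \<in> verts G" for v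
        using ev that by (simp add: x_def eigenfunction_def sum_divide_distrib[symmetric])
      show "0 \<le> x v" for v using f0 \<open>M > 0\<close> by (simp add: x_def)
      show "x v \<le> 1" if "v \<in> verts G" for v using M[OF that] \<open>M > 0\<close> by (simp add: x_def)
      show "0 < lam" using big \<rho>_gt by simp
      show "lam\<^sup>2 - lam \<ge> 7" using lam m by simp
      show "lam\<^sup>2 - lam \<ge> real (card (edges G)) - 1" using lam E by simp
    qed
    have "x u = 1" using u \<open>M > 0\<close> by (simp add: x_def)
    from edges_eq_book[OF u(1) this] show ?thesis by metis
  qed
  have ge: "\<rho> \<le> lam" if "odd m" and iso: "equal_up_to_isolated G (book_graph ((m - 1) div 2))"
  proof -
    have "real ((m - 1) div 2) = (real m - 1) / 2"
      using \<open>odd m\<close> by (auto elim!: oddE)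
    then have "\<rho>\<^sup>2 = \<rho> + 2 * real ((m - 1) div 2)" using \<rho>_sq by simp
    then have "eigenfunction (book_graph ((m - 1) div 2)) \<rho> (case_sum (\<lambda>_. \<rho>) (\<lambda>_. 2))"
      using \<rho>_gt by (intro eigenfunction_book_graph) auto
    then obtain f where "eigenfunction (remove_isolated G) \<rho> f"
      using graph_isomorphic_eigenfunction[OF simple_graph_remove_isolated[OF G] simple_graph_book_graph]
        iso unfolding equal_up_to_isolated_def remove_isolated_book_graph by metis
    from remove_isolated_eigenfunction[OF G this] show ?thesis
      unfolding lam_def by (rule eigenfunction_le_largest_eigenvalue[OF G])
  qed
  \<comment> \<open>The assumption \<open>\<rho> \<le> lam\<close> alone yields the structure and
    then equality, so \<open>lam > \<rho>\<close> is impossible and the upper bound follows from the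
    same argument.\<close>
  have eq: "lam = \<rho>" "odd m" "equal_up_to_isolated G (book_graph ((m - 1) div 2))" if "\<rho> \<le> lam"
  proof -
    obtain u c L where L: "finite L" "u \<noteq> c" "u \<notin> L" "c \<notin> L" and EB: "edges G = book u c L"
      and lam: "lam\<^sup>2 = lam + 2 * real (card L)"
      using book[OF \<open>\<rho> \<le> lam\<close>] by blast
    have mL: "m = 2 * card L + 1" using card_book[OF L] E EB by simp
    then show "odd m" "equal_up_to_isolated G (book_graph ((m - 1) div 2))"
      using equal_up_to_isolated_book[OF G EB L] by simp_all
    \<comment> \<open>Both numbers are roots of the same quadratic, and the second factor is
      positive.\<close>
    have "(lam - \<rho>) * (lam + \<rho> - 1) = 0"
      using lam \<rho>_sq mL by (simp add: power2_eq_square algebra_simps)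
    then show "lam = \<rho>" using that \<rho>_gt by simp
  qed
  have "lam \<le> \<rho>" using eq(1) by linarith
  moreover have "lam = \<rho> \<longleftrightarrow> odd m \<and> equal_up_to_isolated G (book_graph ((m - 1) div 2))"
    using eq ge by fastforce
  ultimately show ?thesis unfolding lam_def \<rho>_def by blast
qed

end
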